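(* For every $d\ge1$: (1) $a_d(2)\equiv3\pmod4$; (2) $a_d(3)\equiv1+3\cdot2^{d-1}\pmod9$. In particular, $2$ and $3$ are tame with respect to every $d$, with $\nu_2(a_d(2)-1)=\nu_3(a_d(3)-1)=1$.
   Context: For integers $d,n\ge1$, $T_d(n)$ is the Cayley graph of $(\mathbb{Z}/n\mathbb{Z})^d$ with respect to $\{\pm e_1,\dots,\pm e_d\}\setminus\{0\}$ ($e_i$ the standard basis vectors); it is a simple graph (for $n=2$ it is the $d$-dimensional hypercube graph). $a_d(n)$ is the number of independent sets of $T_d(n)$ (including the empty set). $\nu_p$ is the $p$-adic valuation with $\nu_p(p)=1$. A prime $p$ is tame with respect to $d$ if $\nu_p(a_d(p^k)-1)=\nu_p(a_d(p)-1)$ for every $k\ge1$. *)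

theory Defs
  imports
    "HOL-Algebra.Elementary_Groups"
    "HOL-Algebra.Product_Groups"
    "HOL-Number_Theory.Number_Theory"
begin

text \<open>A simple graph is given by its vertex set and its set of edges, which are two-element sets
  of vertices.\<close>

type_synonym 'a graph = "'a set \<times> 'a set set"

text \<open>For \<^term>\<open>S\<close> closed under inverses and not containing the identity, this is the (undirected,
  simple) Cayley graph: the edge from \<^term>\<open>x\<close> to \<open>x s\<close> is identified with the one leading back via
  the inverse of \<^term>\<open>s\<close>.\<close>

definition cayley_graph :: "('a, 'b) monoid_scheme \<Rightarrow> 'a set \<Rightarrow> 'a graph" where
  "cayley_graph G S = (carrier G, {{x, x \<otimes>\<^bsub>G\<^esub> s} | x s. x \<in> carrier G \<and> s \<in> S})"

definition independent_sets :: "'a graph \<Rightarrow> 'a set set" where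
  "independent_sets \<Gamma> = {I. I \<subseteq> fst \<Gamma> \<and> (\<forall>e \<in> snd \<Gamma>. \<not> e \<subseteq> I)}"

definition zmod_power :: "nat \<Rightarrow> nat \<Rightarrow> (nat \<Rightarrow> int) monoid" where
  "zmod_power d n = product_group {1..d} (\<lambda>_. integer_mod_group n)"

text \<open>Reducing the entry \<open>1\<close> modulo \<^term>\<open>n\<close> matters only for \<^prop>\<open>n = 1\<close>, where all basis vectors
  are zero.\<close>

definition basis_vector :: "nat \<Rightarrow> nat \<Rightarrow> nat \<Rightarrow> (nat \<Rightarrow> int)" where
  "basis_vector d n i = (\<lambda>j\<in>{1..d}. if j = i then 1 mod int n else 0)"

definition torus_generators :: "nat \<Rightarrow> nat \<Rightarrow> (nat \<Rightarrow> int) set" where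
  "torus_generators d n =
     (basis_vector d n ` {1..d} \<union> (\<lambda>i. inv\<^bsub>zmod_power d n\<^esub> basis_vector d n i) ` {1..d})
       - {\<one>\<^bsub>zmod_power d n\<^esub>}"

definition torus_graph :: "nat \<Rightarrow> nat \<Rightarrow> (nat \<Rightarrow> int) graph" where
  "torus_graph d n = cayley_graph (zmod_power d n) (torus_generators d n)"

definition num_indep :: "nat \<Rightarrow> nat \<Rightarrow> nat" where
  "num_indep d n = card (independent_sets (torus_graph d n))"

text \<open>\<^const>\<open>multiplicity\<close> sends \<open>0\<close> to \<open>0\<close> rather than to infinity; by
  \<open>num_indep_gt_1\<close> below, it is only applied to nonzero integers here.\<close>

definition tame :: "nat \<Rightarrow> nat \<Rightarrow> bool" where
  "tame d p \<longleftrightarrow> prime p \<and>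
     (\<forall>k\<ge>1. multiplicity (int p) (int (num_indep d (p ^ k)) - 1)
            = multiplicity (int p) (int (num_indep d p) - 1))"

lemma group_zmod_power: "group (zmod_power d n)"
  unfolding zmod_power_def by (rule product_group) simp

lemma basis_vector_in_carrier:
  assumes "n \<ge> 1"
  shows "basis_vector d n i \<in> carrier (zmod_power d n)"
  using assms by (auto simp: zmod_power_def basis_vector_def carrier_integer_mod_group)

lemma torus_generators_subset:
  assumes "n \<ge> 1"
  shows "torus_generators d n \<subseteq> carrier (zmod_power d n)"
proof -
  interpret group "zmod_power d n" by (rule group_zmod_power)
  show ?thesis
    using basis_vector_in_carrier[OF assms] by (auto simp: torus_generators_def)
qed

lemma torus_graph_simple:
  assumes "n \<ge> 1" and "e \<in> snd (torus_graph d n)"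
  shows "e \<subseteq> fst (torus_graph d n)" and "card e = 2"
proof -
  interpret group "zmod_power d n" by (rule group_zmod_power)
  obtain x s where e: "e = {x, x \<otimes>\<^bsub>zmod_power d n\<^esub> s}" and x: "x \<in> carrier (zmod_power d n)"
    and s: "s \<in> torus_generators d n"
    using assms(2) by (auto simp: torus_graph_def cayley_graph_def)
  have sc: "s \<in> carrier (zmod_power d n)"
    using torus_generators_subset[OF assms(1)] s by auto
  have "s \<noteq> \<one>\<^bsub>zmod_power d n\<^esub>" using s by (auto simp: torus_generators_def)
  then have "x \<otimes>\<^bsub>zmod_power d n\<^esub> s \<noteq> x" using x sc by simp
  then show "card e = 2" using e by auto
  show "e \<subseteq> fst (torus_graph d n)"
    using e x sc by (auto simp: torus_graph_def cayley_graph_def)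
qed

lemma num_indep_gt_1:
  assumes "n \<ge> 1"
  shows "num_indep d n > 1"
proof -
  let ?G = "zmod_power d n" and ?I = "independent_sets (torus_graph d n)"
  interpret group ?G by (rule group_zmod_power)
  have "finite (carrier ?G)"
    using assms by (auto simp: zmod_power_def carrier_integer_mod_group intro!: finite_PiE)
  then have fin: "finite ?I"
    by (intro finite_subset[of ?I "Pow (carrier ?G)"])
       (auto simp: independent_sets_def torus_graph_def cayley_graph_def)
  have small: "A \<in> ?I" if "A \<subseteq> {\<one>\<^bsub>?G\<^esub>}" for A
  proof -
    have "card A \<le> 1" using card_mono[OF _ that] by simp
    moreover have "finite A" using that finite_subset by blast
    ultimately have "\<not> e \<subseteq> A" if "e \<in> snd (torus_graph d n)" for e
      using torus_graph_simple(2)[OF assms that] card_mono[of A e] by auto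
    moreover have "A \<subseteq> fst (torus_graph d n)"
      using that by (auto simp: torus_graph_def cayley_graph_def)
    ultimately show ?thesis by (auto simp: independent_sets_def)
  qed
  have "card {{}, {\<one>\<^bsub>?G\<^esub>}} \<le> card ?I"
    by (rule card_mono[OF fin]) (use small in auto)
  then show ?thesis by (simp add: num_indep_def)
qed

end

theory Submission
  imports Defs "HOL-Algebra.Group_Action"
begin

text \<open>The group \<open>G = (\<int>/p\<^sup>k)\<^sup>d\<close> acts on the independent sets by translation, and its orbits have
  \<open>p\<close>-power size, so modulo \<open>p\<^sup>2\<close> only the independent sets with an orbit of size \<open>1\<close> or \<open>p\<close> count.
  If such a set \<open>I\<close> is nonempty, independence forces every \<open>e\<^sub>i\<close> to move it; hence its orbit consists
  of the \<open>p\<close> translates by multiples of \<open>e\<^sub>1\<close>, and \<open>e\<^sub>i\<close> acts on it like \<open>c\<^sub>i e\<^sub>1\<close> for a unit \<open>c\<^sub>i\<close> modulo \<open>p\<close>.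
  Thus \<open>I\<close> is a union of level sets of the form \<open>\<Sum> c\<^sub>i x\<^sub>i\<close> modulo \<open>p\<close>, and for \<open>p \<le> 3\<close> of just one, since
  any two distinct residues differ by \<open>\<plusminus>1\<close>. Together with the empty set this gives
  \<open>1 + p (p - 1)\<^sup>d\<^sup>-\<^sup>1\<close> sets, independently of \<open>k\<close>.\<close>

no_notation subset_mset (infix \<open><#\<close> 50)

section \<open>Actions of finite groups of prime power order\<close>

context group_action
begin

lemma finite_orbit:
  assumes "finite (carrier G)"
  shows "finite (orbit G \<phi> x)"
proof -
  have "orbit G \<phi> x = (\<lambda>g. \<phi> g x) ` carrier G"
    by (auto simp: orbit_def)
  then show ?thesis using assms by simp
qed

lemma card_orbit_prime_power:
  assumes "prime p" "order G = p ^ m" "x \<in> E"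
  obtains s where "card (orbit G \<phi> x) = p ^ s"
proof -
  have "card (orbit G \<phi> x) dvd p ^ m"
    using orbit_stabilizer_theorem[OF assms(3)] assms(2) by (metis dvd_triv_left)
  then show thesis
    using that divides_primepow_nat[OF assms(1)] by blast
qed

text \<open>All orbits have \<open>p\<close>-power size, so an orbit that is not smaller than
  \<open>p ^ r\<close> contributes a multiple of \<open>p ^ r\<close>. For \<open>r = 1\<close> this
  is, in essence, the fixed point congruence; the application takes \<open>r = 2\<close>.\<close>

lemma card_cong_small_orbits:
  assumes "prime p" "order G = p ^ m" "finite E"
  shows "[card E = card {x \<in> E. card (orbit G \<phi> x) < p ^ r}] (mod p ^ r)"
proof -
  define S where "S = {x \<in> E. card (orbit G \<phi> x) < p ^ r}"
  \<comment> \<open>The indicator of the complement of \<open>S\<close> turns the cardinality of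
    \<open>E - S\<close> into a sum that can be split over the orbits.\<close>
  define f where "f x = (if x \<in> E - S then 1 else 0 :: nat)" for x
  have "p ^ r dvd (\<Sum>x\<in>orb. f x)" if orb: "orb \<in> orbits G E \<phi>" for orb
  proof -
    obtain x where x: "x \<in> E" "orb = orbit G \<phi> x"
      using orb by (auto simp: orbits_def)
    have sub: "orb \<subseteq> E" using orbits_coverture orb by blast
    \<comment> \<open>Orbits partition \<open>E\<close>, so being small is a property of the whole
      orbit and \<open>f\<close> is constant on it.\<close>
    have same: "orbit G \<phi> y = orb" if "y \<in> orb" for y
    proof -
      have "y \<in> E" using sub that by blast
      moreover have "y \<in> orbit G \<phi> y" using orbit_refl \<open>y \<in> E\<close> by blast
      moreover have "orbit G \<phi> y \<in> orbits G E \<phi>" using \<open>y \<in> E\<close> by (auto simp: orbits_def)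
      ultimately show ?thesis using disjoint_union[OF orb] that by blast
    qed
    obtain s where s: "card orb = p ^ s"
      using card_orbit_prime_power[OF assms(1,2) x(1)] x(2) by blast
    show ?thesis
    proof (cases "card orb < p ^ r")
      case True
      then have "f y = 0" if "y \<in> orb" for y
        using same[OF that] sub that by (auto simp: f_def S_def)
      then show ?thesis by simp
    next
      case False
      then have "f y = 1" if "y \<in> orb" for y
        using same[OF that] sub that by (auto simp: f_def S_def)
      then have "(\<Sum>x\<in>orb. f x) = p ^ s" using s by simp
      moreover have "r \<le> s"
      proof (rule ccontr)
        assume "\<not> r \<le> s"
        then have "p ^ s < p ^ r"
          using prime_gt_1_nat[OF assms(1)] by (intro power_strict_increasing) auto
        then show False using False s by simp
      qed
      ultimately show ?thesis by (simp add: le_imp_power_dvd)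
    qed
  qed
  then have "p ^ r dvd (\<Sum>x\<in>E. f x)"
    unfolding disjoint_sum[OF assms(3), of f, symmetric] by (rule dvd_sum)
  also have "(\<Sum>x\<in>E. f x) = card (E - S)"
    using assms(3) by (simp add: f_def sum.If_cases Diff_eq Collect_neg_eq)
  finally have "[card (E - S) = 0] (mod p ^ r)" by (simp add: cong_0_iff)
  moreover have "card E = card S + card (E - S)"
    using assms(3) card_Un_disjoint[of S "E - S"] by (auto simp: S_def Un_absorb1)
  ultimately have "[card E = card S + 0] (mod p ^ r)"
    using cong_add_lcancel_nat by presburger
  then show ?thesis by (simp add: S_def)
qed

lemma group_G: "group G"
  using group_hom group_hom.axioms(1) by auto

lemma action_pow_fixed:
  assumes "x \<in> E" "g \<in> carrier G" "\<phi> g x = x"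
  shows "\<phi> (g [^]\<^bsub>G\<^esub> (n::nat)) x = x"
proof -
  interpret group G by (rule group_G)
  show ?thesis
  proof (induction n)
    case 0
    then show ?case using id_eq_one assms(1) by (metis nat_pow_0 restrict_apply')
  next
    case (Suc n)
    then show ?case using assms by (simp add: composition_rule)
  qed
qed

text \<open>Writing \<open>a = p * (a div p) + a mod p\<close>, the part of the power that comes
  from \<open>g [^] p\<close> fixes \<open>x\<close>.\<close>

lemma action_pow_mod:
  assumes "x \<in> E" "g \<in> carrier G" "\<phi> (g [^]\<^bsub>G\<^esub> (p::nat)) x = x"
  shows "\<phi> (g [^]\<^bsub>G\<^esub> a) x = \<phi> (g [^]\<^bsub>G\<^esub> (a mod p)) x"
proof -
  interpret group G by (rule group_G)
  have "g [^] a = g [^] (a mod p) \<otimes> (g [^] p) [^] (a div p)"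
    using assms(2) by (simp add: nat_pow_pow nat_pow_mult)
  then show ?thesis
    using assms action_pow_fixed[OF assms(1) _ assms(3)] by (simp add: composition_rule)
qed

text \<open>The orbit size is a power of \<open>p\<close> below \<open>p\<^sup>2\<close>, hence at
  most \<open>p\<close>. The first \<open>p\<close> powers of \<open>g\<close> already move
  \<open>x\<close> to \<open>p\<close> distinct points, so they exhaust the orbit.\<close>

lemma prime_orbit_by_powers:
  assumes "prime p" "order G = p ^ m" "x \<in> E" "g \<in> carrier G"
    and moved: "\<phi> g x \<noteq> x" and small: "card (orbit G \<phi> x) < p\<^sup>2"
  shows "orbit G \<phi> x = (\<lambda>j::nat. \<phi> (g [^]\<^bsub>G\<^esub> j) x) ` {..<p}"
    and "\<phi> (g [^]\<^bsub>G\<^esub> p) x = x"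
proof -
  interpret group G by (rule group_G)
  have p: "p > 1" using assms(1) prime_gt_1_nat by blast
  have fin: "finite (orbit G \<phi> x)"
    using finite_orbit order_gt_0_iff_finite assms(2) p by simp
  have le: "card (orbit G \<phi> x) \<le> p"
  proof -
    obtain s where s: "card (orbit G \<phi> x) = p ^ s"
      using card_orbit_prime_power[OF assms(1-3)] by blast
    then have "s < 2" using small p power_less_imp_less_exp by metis
    then have "p ^ s \<le> p ^ 1" using p by (intro power_increasing) auto
    then show ?thesis using s by simp
  qed
  have gord: "g [^] (p ^ m) = \<one>" using pow_order_eq_1[OF assms(4)] assms(2) by simp
  \<comment> \<open>The exponent \<open>j\<close> is coprime to the group order, so \<open>g\<close>
    is itself a power of \<open>g [^] j\<close> by Bezout; a point fixed by \<open>g [^] j\<close>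
    would be fixed by \<open>g\<close>.\<close>
  have nofix: "\<phi> (g [^] j) x \<noteq> x" if j: "0 < j" "j < p" for j :: nat
  proof
    assume fx: "\<phi> (g [^] j) x = x"
    have "coprime j (p ^ m)"
      using j assms(1) by (metis coprime_commute coprime_power_right_iff nat_dvd_not_less prime_imp_coprime)
    then obtain u v where uv: "j * u = p ^ m * v + 1"
      using bezout_nat[of j "p ^ m"] j by auto
    have "\<phi> ((g [^] j) [^] u) x = x"
      using action_pow_fixed[OF assms(3) _ fx] assms(4) by simp
    moreover have "(g [^] j) [^] u = (g [^] (p ^ m)) [^] v \<otimes> g"
      using uv assms(4) by (simp add: nat_pow_pow)
    ultimately show False using gord moved assms(4) by simp
  qed
  have inj: "inj_on (\<lambda>j::nat. \<phi> (g [^] j) x) {..<p}"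
  proof -
    have "False" if ij: "i < j" "j < p" and eq: "\<phi> (g [^] i) x = \<phi> (g [^] j) x" for i j :: nat
    proof -
      have "g [^] j = g [^] i \<otimes> g [^] (j - i)"
        using ij assms(4) by (simp add: nat_pow_mult)
      then have "\<phi> (g [^] i) (\<phi> (g [^] (j - i)) x) = \<phi> (g [^] i) x"
        using eq assms by (simp add: composition_rule)
      then have "\<phi> (g [^] (j - i)) x = x"
        using inj_prop[of "g [^] i"] assms element_image by (meson inj_on_eq_iff nat_pow_closed)
      then show False using nofix[of "j - i"] ij by simp
    qed
    then show ?thesis unfolding inj_on_def by (metis lessThan_iff nat_neq_iff)
  qed
  have sub: "(\<lambda>j::nat. \<phi> (g [^] j) x) ` {..<p} \<subseteq> orbit G \<phi> x"
    using assms(4) by (auto simp: orbit_def)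
  show orb: "orbit G \<phi> x = (\<lambda>j::nat. \<phi> (g [^] j) x) ` {..<p}"
    by (rule card_seteq[symmetric, OF fin sub]) (simp add: card_image[OF inj] le)
  have "\<phi> (g [^] p) x \<in> orbit G \<phi> x"
    using assms(4) by (auto simp: orbit_def)
  \<comment> \<open>Cancelling \<open>g [^] j\<close> shows that \<open>g [^] (p - j)\<close> fixes
    \<open>x\<close>, and \<open>nofix\<close> leaves only \<open>j = 0\<close>.\<close>
  then obtain j where j: "j < p" "\<phi> (g [^] p) x = \<phi> (g [^] j) x"
    using orb by auto
  have "g [^] p = g [^] j \<otimes> g [^] (p - j)"
    using j assms(4) by (simp add: nat_pow_mult)
  then have "\<phi> (g [^] j) (\<phi> (g [^] (p - j)) x) = \<phi> (g [^] j) x"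
    using j assms by (simp add: composition_rule)
  then have "\<phi> (g [^] (p - j)) x = x"
    using inj_prop[of "g [^] j"] assms element_image by (meson inj_on_eq_iff nat_pow_closed)
  then have "j = 0" using nofix[of "p - j"] j by (cases "j = 0") auto
  then show "\<phi> (g [^] p) x = x"
    using j id_eq_one assms(3) by (metis nat_pow_0 restrict_apply')
qed

end

section \<open>Translations of independent sets in a Cayley graph\<close>

lemma (in group) mem_l_coset_mult_iff:
  assumes "M \<subseteq> carrier G" "g \<in> carrier G" "x \<in> carrier G"
  shows "g \<otimes> x \<in> g <# M \<longleftrightarrow> x \<in> M"
  using assms by (auto simp: l_coset_def)

text \<open>Both memberships say that the one element \<open>x \<otimes> y\<close> lies in the
  common translate. This converts equal translates into statements about elements.\<close>

lemma (in comm_group) mem_iff_of_l_coset_eq: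
  assumes "M \<subseteq> carrier G" "x \<in> carrier G" "y \<in> carrier G" "x <# M = y <# M"
  shows "x \<in> M \<longleftrightarrow> y \<in> M"
  using assms mem_l_coset_mult_iff[of M x y] mem_l_coset_mult_iff[of M y x] by (metis m_comm)

lemma (in group) l_coset_inverse:
  assumes "M \<subseteq> carrier G" "g \<in> carrier G"
  shows "inv g <# (g <# M) = M" "g <# (inv g <# M) = M"
  using assms by (simp_all add: lcos_m_assoc lcos_mult_one)

text \<open>Generators multiply from the right, so left translation maps edges to edges; an edge
  inside the translate pulls back to an edge inside \<open>I\<close>.\<close>

lemma (in group) l_coset_independent_sets:
  assumes "S \<subseteq> carrier G" "g \<in> carrier G" "I \<in> independent_sets (cayley_graph G S)"
  shows "g <# I \<in> independent_sets (cayley_graph G S)"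
proof -
  have I: "I \<subseteq> carrier G" using assms(3) by (simp add: independent_sets_def cayley_graph_def)
  have ind: "\<not> {x, x \<otimes> s} \<subseteq> I" if "x \<in> carrier G" "s \<in> S" for x s
    using assms(3) that unfolding independent_sets_def cayley_graph_def by auto
  have False if x: "x \<in> carrier G" "s \<in> S" "{x, x \<otimes> s} \<subseteq> g <# I" for x s
  proof -
    have s: "s \<in> carrier G" using x assms(1) by blast
    obtain y where y: "y \<in> I" "x = g \<otimes> y" using x by (auto simp: l_coset_def)
    then have yc: "y \<in> carrier G" using I by blast
    have "g \<otimes> (y \<otimes> s) \<in> g <# I" using x y s yc assms(2) by (simp add: m_assoc)
    then have "y \<otimes> s \<in> I" using mem_l_coset_mult_iff[OF I assms(2)] s yc by simp
    then show False using ind[OF yc x(2)] y by simp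
  qed
  moreover have "g <# I \<subseteq> carrier G" using l_coset_subset_G[OF I assms(2)] .
  ultimately show ?thesis
    unfolding independent_sets_def cayley_graph_def by auto
qed

text \<open>\<open>Bij E\<close> consists of extensional functions, hence the restriction of each
  translation to \<open>E\<close>. Its inverse is translation by \<open>inv g\<close>.\<close>

lemma (in group) translation_action:
  assumes "S \<subseteq> carrier G"
  defines "E \<equiv> independent_sets (cayley_graph G S)"
  shows "group_action G E (\<lambda>g. \<lambda>I\<in>E. g <# I)"
proof -
  let ?\<phi> = "\<lambda>g. \<lambda>I\<in>E. g <# I"
  have closed: "g <# I \<in> E" if "g \<in> carrier G" "I \<in> E" for g I
    using l_coset_independent_sets assms that by simp
  have sub: "I \<subseteq> carrier G" if "I \<in> E" for I
    using that by (simp add: E_def independent_sets_def cayley_graph_def)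
  have bij: "?\<phi> g \<in> Bij E" if g: "g \<in> carrier G" for g
  proof -
    have "bij_betw (\<lambda>I. g <# I) E E"
      by (rule bij_betwI[where g = "\<lambda>I. inv g <# I"]) (use g closed sub l_coset_inverse in auto)
    then show ?thesis by (simp add: Bij_def)
  qed
  have "?\<phi> (g \<otimes> h) = compose E (?\<phi> g) (?\<phi> h)" if "g \<in> carrier G" "h \<in> carrier G" for g h
    using that closed sub by (auto simp: compose_def fun_eq_iff lcos_m_assoc)
  then have "?\<phi> \<in> hom G (BijGroup E)"
    using bij by (auto simp: hom_def BijGroup_def)
  then show ?thesis
    by (simp add: group_action_def group_hom_def group_hom_axioms_def group_BijGroup is_group)
qed

section \<open>Level sets of linear forms on the torus\<close>

lemma carrier_zmod_power:
  "n \<ge> 1 \<Longrightarrow> carrier (zmod_power d n) = (\<Pi>\<^sub>E i\<in>{1..d}. {0..<int n})"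
  by (simp add: zmod_power_def carrier_integer_mod_group)

lemma mult_zmod_power:
  "x \<otimes>\<^bsub>zmod_power d n\<^esub> y = (\<lambda>i\<in>{1..d}. (x i + y i) mod int n)"
  by (simp add: zmod_power_def)

lemma one_zmod_power: "\<one>\<^bsub>zmod_power d n\<^esub> = (\<lambda>i\<in>{1..d}. 0)"
  by (simp add: zmod_power_def)

lemma comm_group_zmod_power: "comm_group (zmod_power d n)"
  by (rule group.group_comm_groupI[OF group_zmod_power])
     (simp add: mult_zmod_power add.commute)

lemma order_zmod_power: "n \<ge> 1 \<Longrightarrow> order (zmod_power d n) = n ^ d"
  by (simp add: order_def carrier_zmod_power card_PiE)

text \<open>Every point is reached from the identity by raising one coordinate at a time without
  wrapping around modulo \<open>n\<close>, so a linear form changes in each step by an exact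
  integer. The induction is on the coordinate sum.\<close>

lemma zmod_power_induct [consumes 2, case_names one step]:
  assumes "n \<ge> 1" "x \<in> carrier (zmod_power d n)"
  assumes one: "P \<one>\<^bsub>zmod_power d n\<^esub>"
    and step: "\<And>x i. x \<in> carrier (zmod_power d n) \<Longrightarrow> i \<in> {1..d} \<Longrightarrow> x i + 1 < int n \<Longrightarrow> P x \<Longrightarrow>
                 P (x(i := x i + 1))"
  shows "P x"
  using assms(2)
proof (induction "nat (\<Sum>i=1..d. x i)" arbitrary: x rule: less_induct)
  case less
  have x: "0 \<le> x i" "x i < int n" if "i \<in> {1..d}" for i
    using less.prems that assms(1) by (auto simp: carrier_zmod_power PiE_iff)
  have ext: "x \<in> extensional {1..d}"
    using less.prems assms(1) by (auto simp: carrier_zmod_power PiE_iff)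
  show ?case
  proof (cases "\<forall>i\<in>{1..d}. x i = 0")
    case True
    then have "x = \<one>\<^bsub>zmod_power d n\<^esub>"
      using ext by (auto simp: one_zmod_power extensional_def fun_eq_iff)
    then show ?thesis using one by simp
  next
    case False
    then obtain i where i: "i \<in> {1..d}" "x i > 0" using x by force
    define y where "y = x(i := x i - 1)"
    have y: "y \<in> carrier (zmod_power d n)"
      using x ext assms(1) i by (force simp: carrier_zmod_power PiE_iff y_def extensional_def)
    have "(\<Sum>k=1..d. y k) < (\<Sum>k=1..d. x k)"
      by (rule sum_strict_mono_ex1) (use i in \<open>auto simp: y_def\<close>)
    moreover have "0 \<le> (\<Sum>k=1..d. y k)"
      by (rule sum_nonneg) (use x i in \<open>auto simp: y_def\<close>)
    ultimately have "P y" using less.hyps y by simp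
    moreover have "y i + 1 < int n" using x(2)[OF i(1)] by (simp add: y_def)
    ultimately have "P (y(i := y i + 1))" using step y i by blast
    then show ?thesis by (simp add: y_def)
  qed
qed

text \<open>Kept as an integer rather than a residue modulo \<open>p\<close>: the classification of
  small orbits uses its value as an exponent.\<close>

definition linear_form :: "nat \<Rightarrow> (nat \<Rightarrow> int) \<Rightarrow> (nat \<Rightarrow> int) \<Rightarrow> int" where
  "linear_form d c x = (\<Sum>i=1..d. c i * x i)"

definition level_set :: "nat \<Rightarrow> nat \<Rightarrow> nat \<Rightarrow> (nat \<Rightarrow> int) \<Rightarrow> int \<Rightarrow> (nat \<Rightarrow> int) set" where
  "level_set d n p c j = {x \<in> carrier (zmod_power d n). linear_form d c x mod int p = j}"

text \<open>Fixing the first coefficient picks one representative of each linear form up to scaling.\<close>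

definition unit_coeffs :: "nat \<Rightarrow> nat \<Rightarrow> (nat \<Rightarrow> int) set" where
  "unit_coeffs d p = (\<Pi>\<^sub>E i\<in>{1..d}. if i = 1 then {1} else {1..<int p})"

lemma unit_coeffs_range:
  assumes "c \<in> unit_coeffs d p" "i \<in> {1..d}" "p > 1"
  shows "1 \<le> c i" "c i < int p"
proof -
  have "c i \<in> (if i = 1 then {1} else {1..<int p})"
    using assms(1,2) unfolding unit_coeffs_def by (rule PiE_mem)
  then show "1 \<le> c i" "c i < int p" using assms(3) by (simp_all split: if_split_asm)
qed

lemma unit_coeffs_first:
  assumes "c \<in> unit_coeffs d p" "d \<ge> 1"
  shows "c 1 = 1"
  using PiE_mem[OF assms(1)[unfolded unit_coeffs_def], of 1] assms(2) by simp

lemma card_unit_coeffs: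
  assumes "d \<ge> 1"
  shows "card (unit_coeffs d p) = (p - 1) ^ (d - 1)"
proof -
  have "card (unit_coeffs d p) = (\<Prod>i=1..d. if i = 1 then 1 else p - 1)"
    unfolding unit_coeffs_def by (subst card_PiE) (auto intro!: prod.cong simp: nat_diff_distrib')
  also have "{1..d} = insert 1 {2..d}" using assms by auto
  also have "(\<Prod>i\<in>insert 1 {2..d}. if i = 1 then 1 else p - 1) = (\<Prod>i=2..d. p - 1)"
    by (subst prod.insert) (auto intro!: prod.cong)
  finally show ?thesis by (simp add: Suc_diff_le numeral_2_eq_2)
qed

text \<open>Reduction of coordinates modulo \<open>n\<close> is invisible modulo \<open>p\<close>
  when \<open>p\<close> divides \<open>n\<close>; thus the form is a homomorphism modulo
  \<open>p\<close>.\<close>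

lemma linear_form_mult:
  assumes "int p dvd int n"
  shows "[linear_form d c (x \<otimes>\<^bsub>zmod_power d n\<^esub> y) = linear_form d c x + linear_form d c y] (mod int p)"
proof -
  have "[(x i + y i) mod int n = x i + y i] (mod int p)" for i
    using assms by (simp add: cong_def mod_mod_cancel)
  then have "[(\<Sum>i=1..d. c i * ((x i + y i) mod int n)) = (\<Sum>i=1..d. c i * (x i + y i))] (mod int p)"
    by (intro cong_sum cong_mult cong_refl)
  then show ?thesis
    by (simp add: linear_form_def mult_zmod_power distrib_left sum.distrib)
qed

lemma linear_form_one [simp]: "linear_form d c \<one>\<^bsub>zmod_power d n\<^esub> = 0"
  by (simp add: linear_form_def one_zmod_power)

lemma linear_form_upd:
  assumes "i \<in> {1..d}"
  shows "linear_form d c (x(i := x i + a)) = linear_form d c x + c i * a"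
proof -
  have "linear_form d c (x(i := x i + a)) = (\<Sum>k=1..d. c k * x k + (if k = i then c i * a else 0))"
    unfolding linear_form_def by (intro sum.cong) (auto simp: distrib_left)
  then show ?thesis using assms by (simp add: sum.distrib linear_form_def)
qed

lemma basis_vector_eq:
  assumes "n > 1"
  shows "basis_vector d n i = (\<lambda>j\<in>{1..d}. if j = i then 1 else 0)"
  using assms by (simp add: basis_vector_def fun_eq_iff)

lemma linear_form_basis_vector:
  assumes "n > 1" "i \<in> {1..d}"
  shows "linear_form d c (basis_vector d n i) = c i"
proof -
  have "linear_form d c (basis_vector d n i) = (\<Sum>k=1..d. if k = i then c k else 0)"
    unfolding linear_form_def by (intro sum.cong) (auto simp: basis_vector_eq[OF assms(1)])
  then show ?thesis using assms by simp
qed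

lemma zmod_power_mult_basis_vector:
  assumes "n > 1" "x \<in> carrier (zmod_power d n)" "i \<in> {1..d}" "x i + 1 < int n"
  shows "x \<otimes>\<^bsub>zmod_power d n\<^esub> basis_vector d n i = x(i := x i + 1)"
proof
  fix k
  show "(x \<otimes>\<^bsub>zmod_power d n\<^esub> basis_vector d n i) k = (x(i := x i + 1)) k"
    using assms by (auto simp: mult_zmod_power basis_vector_eq carrier_zmod_power PiE_iff extensional_def)
qed

lemma basis_vector_in_torus_generators:
  assumes "n > 1" "i \<in> {1..d}"
  shows "basis_vector d n i \<in> torus_generators d n"
proof -
  have "basis_vector d n i i \<noteq> \<one>\<^bsub>zmod_power d n\<^esub> i"
    using assms by (simp add: basis_vector_eq one_zmod_power)
  then have "basis_vector d n i \<noteq> \<one>\<^bsub>zmod_power d n\<^esub>" by auto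
  then show ?thesis using assms(2) by (auto simp: torus_generators_def)
qed

lemma linear_form_torus_generator:
  assumes "n > 1" "int p dvd int n" "s \<in> torus_generators d n"
  obtains i where "i \<in> {1..d}" "[linear_form d c s = c i] (mod int p) \<or> [linear_form d c s = - c i] (mod int p)"
proof -
  interpret comm_group "zmod_power d n" by (rule comm_group_zmod_power)
  obtain i where i: "i \<in> {1..d}"
    and s: "s = basis_vector d n i \<or> s = inv\<^bsub>zmod_power d n\<^esub> basis_vector d n i"
    using assms(3) by (auto simp: torus_generators_def)
  have b: "basis_vector d n i \<in> carrier (zmod_power d n)"
    using basis_vector_in_carrier assms(1) by simp
  have "[linear_form d c s = - c i] (mod int p)" if "s = inv\<^bsub>zmod_power d n\<^esub> basis_vector d n i"
  proof -
    have "[0 = linear_form d c s + c i] (mod int p)"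
      using linear_form_mult[OF assms(2), of d c s "basis_vector d n i"] that b
        linear_form_basis_vector[OF assms(1) i] by simp
    then have "[0 + - c i = linear_form d c s + c i + - c i] (mod int p)"
      by (simp only: cong_add_rcancel)
    then show ?thesis by (simp add: cong_sym)
  qed
  moreover have "[linear_form d c s = c i] (mod int p)" if "s = basis_vector d n i"
    using linear_form_basis_vector[OF assms(1) i] that by simp
  ultimately show thesis using s i that by blast
qed

section \<open>Independence, translates and distinctness of level sets\<close>

text \<open>Along an edge the form changes by some \<open>c i\<close> or \<open>- c i\<close> modulo
  \<open>p\<close>, which is nonzero because \<open>c i\<close> lies strictly between
  \<open>0\<close> and \<open>p\<close>.\<close>

lemma level_set_independent:
  assumes "n > 1" "int p dvd int n" "c \<in> unit_coeffs d p" "p > 1"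
  shows "level_set d n p c j \<in> independent_sets (torus_graph d n)"
proof -
  have False
    if x: "x \<in> level_set d n p c j" "x \<otimes>\<^bsub>zmod_power d n\<^esub> s \<in> level_set d n p c j"
      and s: "s \<in> torus_generators d n" for x s
  proof -
    obtain i where i: "i \<in> {1..d}"
      "[linear_form d c s = c i] (mod int p) \<or> [linear_form d c s = - c i] (mod int p)"
      using linear_form_torus_generator[OF assms(1,2) s] .
    have "[linear_form d c x + linear_form d c s = linear_form d c x + 0] (mod int p)"
      using x linear_form_mult[OF assms(2), of d c x s] by (simp add: level_set_def cong_def)
    then have "[linear_form d c s = 0] (mod int p)" by (simp only: cong_add_lcancel)
    then have "int p dvd c i"
      using i(2) by (metis cong_0_iff cong_sym_eq cong_trans dvd_minus_iff)
    then show False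
      using unit_coeffs_range[OF assms(3) i(1) assms(4)] zdvd_imp_le by fastforce
  qed
  then show ?thesis
    by (auto simp: independent_sets_def torus_graph_def cayley_graph_def level_set_def)
qed

lemma level_set_translate:
  assumes "int p dvd int n" "g \<in> carrier (zmod_power d n)"
  shows "g <#\<^bsub>zmod_power d n\<^esub> level_set d n p c j \<subseteq> level_set d n p c ((linear_form d c g + j) mod int p)"
proof -
  interpret comm_group "zmod_power d n" by (rule comm_group_zmod_power)
  have "linear_form d c (g \<otimes>\<^bsub>zmod_power d n\<^esub> x) mod int p = (linear_form d c g + linear_form d c x mod int p) mod int p"
    for x
    using linear_form_mult[OF assms(1), of d c g x] by (simp add: cong_def mod_add_right_eq)
  then show ?thesis using assms(2) by (auto simp: l_coset_def level_set_def)
qed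

text \<open>The reverse inclusion comes from applying \<open>level_set_translate\<close> to the
  inverse of \<open>g\<close> and translating back by \<open>g\<close>.\<close>

lemma level_set_translate_eq:
  assumes "int p dvd int n" "g \<in> carrier (zmod_power d n)" "j \<in> {0..<int p}"
  shows "g <#\<^bsub>zmod_power d n\<^esub> level_set d n p c j = level_set d n p c ((linear_form d c g + j) mod int p)"
proof
  let ?G = "zmod_power d n"
  interpret comm_group ?G by (rule comm_group_zmod_power)
  let ?j = "(linear_form d c g + j) mod int p"
  show "g <#\<^bsub>?G\<^esub> level_set d n p c j \<subseteq> level_set d n p c ?j"
    by (rule level_set_translate[OF assms(1,2)])
  have sub: "level_set d n p c i \<subseteq> carrier ?G" for i by (auto simp: level_set_def)
  have "[linear_form d c (inv\<^bsub>?G\<^esub> g) + linear_form d c g = 0] (mod int p)"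
    using linear_form_mult[OF assms(1), of d c "inv\<^bsub>?G\<^esub> g" g] assms(2) by (simp add: cong_sym)
  then have "[linear_form d c (inv\<^bsub>?G\<^esub> g) + linear_form d c g + j = 0 + j] (mod int p)"
    by (simp only: cong_add_rcancel)
  then have "(linear_form d c (inv\<^bsub>?G\<^esub> g) + ?j) mod int p = j"
    using assms(3) by (simp add: cong_def mod_add_right_eq add.assoc)
  then have "inv\<^bsub>?G\<^esub> g <#\<^bsub>?G\<^esub> level_set d n p c ?j \<subseteq> level_set d n p c j"
    using level_set_translate[OF assms(1), of "inv\<^bsub>?G\<^esub> g" d c ?j] assms(2) by simp
  then have "g <#\<^bsub>?G\<^esub> (inv\<^bsub>?G\<^esub> g <#\<^bsub>?G\<^esub> level_set d n p c ?j) \<subseteq> g <#\<^bsub>?G\<^esub> level_set d n p c j"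
    by (auto simp: l_coset_def)
  then show "level_set d n p c ?j \<subseteq> g <#\<^bsub>?G\<^esub> level_set d n p c j"
    using l_coset_inverse(2)[OF sub assms(2)] by simp
qed

lemma first_axis_in_carrier:
  assumes "n \<ge> 1" "d \<ge> 1" "a \<in> {0..<int n}"
  shows "(\<one>\<^bsub>zmod_power d n\<^esub>)(1 := a) \<in> carrier (zmod_power d n)"
  using assms by (auto simp: carrier_zmod_power one_zmod_power PiE_iff extensional_def)

lemma linear_form_first_axis:
  assumes "c \<in> unit_coeffs d p" "d \<ge> 1"
  shows "linear_form d c ((\<one>\<^bsub>zmod_power d n\<^esub>)(1 := a)) = a"
proof -
  have "\<one>\<^bsub>zmod_power d n\<^esub> 1 = 0" using assms(2) by (simp add: one_zmod_power)
  then show ?thesis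
    using linear_form_upd[of 1 d c "\<one>\<^bsub>zmod_power d n\<^esub>" a] assms(2) unit_coeffs_first[OF assms] by simp
qed

text \<open>Test points recover the data: multiples of the first basis vector detect
  \<open>j\<close>, and adding the \<open>i\<close>-th basis vector to one of them detects
  \<open>c i\<close>.\<close>

lemma level_set_injective:
  assumes "n > 1" "int p dvd int n" "p > 1" "d \<ge> 1"
    and c: "c \<in> unit_coeffs d p" "c' \<in> unit_coeffs d p"
    and j: "j \<in> {0..<int p}" "j' \<in> {0..<int p}"
    and eq: "level_set d n p c j = level_set d n p c' j'"
  shows "c = c'" "j = j'"
proof -
  \<comment> \<open>Residues below \<open>p\<close> are therefore legitimate coordinates modulo
    \<open>n\<close>.\<close>
  have pn: "int p \<le> int n" using assms(1,2) zdvd_imp_le by fastforce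
  define u where "u a = (\<one>\<^bsub>zmod_power d n\<^esub>)(1 := a)" for a :: int
  have u: "u a \<in> carrier (zmod_power d n)" if "a \<in> {0..<int p}" for a
    using that pn assms(1,4) first_axis_in_carrier[of n d a] by (simp add: u_def)
  have lu: "linear_form d e (u a) = a" if "e \<in> unit_coeffs d p" for e a
    using linear_form_first_axis[OF that assms(4)] by (simp add: u_def)
  have "u j \<in> level_set d n p c j"
    using u[OF j(1)] lu[OF c(1), of j] j(1) by (simp add: level_set_def)
  then have "u j \<in> level_set d n p c' j'" using eq by simp
  then show jj: "j = j'"
    using lu[OF c(2), of j] j(1) by (simp add: level_set_def)
  have "c i = c' i" if i: "i \<in> {1..d}" for i
  proof (cases "i = 1")
    case True
    then show ?thesis using unit_coeffs_first assms(4) c by metis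
  next
    case False
    \<comment> \<open>With this \<open>a\<close>, the point \<open>v\<close> has form value
      \<open>a + c i\<close>, congruent to \<open>j\<close>. Equality of the level sets forces the
      same for \<open>a + c' i\<close>.\<close>
    define a where "a = (j - c i) mod int p"
    have a: "a \<in> {0..<int p}" using assms(3) by (simp add: a_def)
    define v where "v = (u a)(i := 1)"
    have ui: "u a i = 0" using i False by (simp add: u_def one_zmod_power)
    have lv: "linear_form d e v = a + e i" if "e \<in> unit_coeffs d p" for e
      using linear_form_upd[OF i, of e "u a" 1] lu[OF that] ui by (simp add: v_def)
    have vc: "v \<in> carrier (zmod_power d n)"
      using u[OF a] i assms(1) by (auto simp: v_def carrier_zmod_power PiE_iff extensional_def)
    have "v \<in> level_set d n p c j"
      using vc lv[OF c(1)] j by (simp add: level_set_def a_def mod_add_left_eq)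
    then have "v \<in> level_set d n p c' j" using eq jj by simp
    then have "(a + c' i) mod int p = (a + c i) mod int p"
      using lv[OF c(2)] j by (simp add: level_set_def a_def mod_add_left_eq)
    then have "[c' i = c i] (mod int p)" by (simp add: cong_def[symmetric] cong_add_lcancel)
    then show ?thesis
      using unit_coeffs_range[OF c(1) i assms(3)] unit_coeffs_range[OF c(2) i assms(3)]
      by (simp add: cong_def)
  qed
  then show "c = c'" using c unfolding unit_coeffs_def by (metis PiE_ext)
qed

lemma level_set_nonempty:
  assumes "n > 1" "int p dvd int n" "p > 1" "d \<ge> 1" "c \<in> unit_coeffs d p" "j \<in> {0..<int p}"
  shows "level_set d n p c j \<noteq> {}"
proof -
  have "int p \<le> int n" using assms(1,2) zdvd_imp_le by fastforce
  then have "(\<one>\<^bsub>zmod_power d n\<^esub>)(1 := j) \<in> level_set d n p c j"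
    using assms first_axis_in_carrier[of n d j] linear_form_first_axis[OF assms(5,4)]
    by (simp add: level_set_def)
  then show ?thesis by blast
qed

section \<open>Independent sets with small orbits\<close>

text \<open>The induction step for showing that every translation acts on \<open>I\<close> like a
  power of \<open>g\<close>; commutativity lets the two powers combine.\<close>

lemma (in comm_group) l_coset_mult_eq_pow:
  assumes "I \<subseteq> carrier G" "x \<in> carrier G" "b \<in> carrier G" "g \<in> carrier G"
    and "x <# I = g [^] (k::nat) <# I" "b <# I = g [^] (l::nat) <# I"
  shows "(x \<otimes> b) <# I = g [^] (k + l) <# I"
proof -
  have "(x \<otimes> b) <# I = x <# (g [^] l <# I)"
    using assms lcos_m_assoc[of I x b] by simp
  also have "\<dots> = (g [^] l \<otimes> x) <# I"
    using assms by (simp add: lcos_m_assoc m_comm)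
  also have "\<dots> = g [^] l <# (g [^] k <# I)"
    using assms lcos_m_assoc[of I "g [^] l" x] by simp
  also have "\<dots> = g [^] (k + l) <# I"
    using assms by (simp add: lcos_m_assoc nat_pow_mult add.commute)
  finally show ?thesis .
qed

text \<open>Each \<open>x\<close> translates \<open>I\<close> exactly as the power of
  \<open>g\<close> with exponent \<open>linear_form d c x\<close> does, so membership in
  \<open>I\<close> depends only on that exponent modulo \<open>p\<close>.\<close>

lemma small_orbit_is_level_set:
  fixes p k d :: nat and G (structure)
  defines "n \<equiv> p ^ k"
  defines "G \<equiv> zmod_power d n"
  defines "E \<equiv> independent_sets (torus_graph d n)"
  defines "\<phi> \<equiv> (\<lambda>g. \<lambda>I\<in>E. g <#\<^bsub>G\<^esub> I)"
  assumes p: "p = 2 \<or> p = 3" and k: "k \<ge> 1" and d: "d \<ge> 1"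
    and I: "I \<in> E" "I \<noteq> {}" and small: "card (orbit G \<phi> I) < p\<^sup>2"
  obtains c j where "c \<in> unit_coeffs d p" "j \<in> {0..<int p}" "I = level_set d n p c j"
proof -
  have prime: "prime p" using p by auto
  have n: "n > 1" using k prime_gt_1_nat[OF prime] by (simp add: n_def one_less_power del: One_nat_def)
  interpret comm_group G unfolding G_def by (rule comm_group_zmod_power)
  interpret act: group_action G E \<phi>
    using translation_action[of "torus_generators d n"] torus_generators_subset[of n d] n
    unfolding E_def \<phi>_def G_def torus_graph_def by simp
  have ord: "order G = p ^ (k * d)"
    using order_zmod_power[of n d] n by (simp add: G_def n_def power_mult)
  have sub: "I \<subseteq> carrier G"
    using I(1) by (simp add: E_def independent_sets_def torus_graph_def cayley_graph_def G_def)
  define b where "b = basis_vector d n"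
  have b: "b i \<in> carrier G" for i
    using basis_vector_in_carrier n by (simp add: b_def G_def)
  have edge: False if "x \<in> I" "x \<otimes> b i \<in> I" "i \<in> {1..d}" for x i
  proof -
    have "{x, x \<otimes> b i} \<in> snd (torus_graph d n)"
      using that sub basis_vector_in_torus_generators[OF n that(3)]
      unfolding torus_graph_def cayley_graph_def b_def G_def by auto
    then show False using I(1) that by (auto simp: E_def independent_sets_def)
  qed
  \<comment> \<open>If \<open>b i\<close> stabilised \<open>I\<close>, any \<open>y\<close> in
    \<open>I\<close> would have its neighbour \<open>y \<otimes> b i\<close> in \<open>I\<close> as
    well.\<close>
  have moved: "b i <# I \<noteq> I" if "i \<in> {1..d}" for i
  proof
    assume eq: "b i <# I = I"
    obtain y where y: "y \<in> I" using I(2) by blast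
    then have "b i \<otimes> y \<in> I" using mem_l_coset_mult_iff[OF sub b[of i]] sub eq by blast
    then show False using edge[OF y _ that] y b[of i] sub by (metis m_comm subsetD)
  qed
  define g where "g = b 1"
  have g: "g \<in> carrier G" using b by (simp add: g_def)
  have "\<phi> g I \<noteq> I" using moved[of 1] d I(1) by (simp add: \<phi>_def g_def)
  note powers = act.prime_orbit_by_powers[OF prime ord I(1) g this small]
  \<comment> \<open>The translate by \<open>b i\<close> lies in the orbit, hence comes from some
    \<open>g [^] l\<close> with \<open>l < p\<close>, and \<open>moved\<close> excludes
    \<open>l = 0\<close>. Since \<open>g\<close> is \<open>b 1\<close>, the choice
    \<open>l = 1\<close> for \<open>i = 1\<close> matches the normalisation in
    \<open>unit_coeffs\<close>.\<close>
  have "\<exists>l::nat. b i <# I = g [^] l <# I \<and> int l \<in> (if i = 1 then {1} else {1..<int p})"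
    if i: "i \<in> {1..d}" for i
  proof (cases "i = 1")
    case True
    then show ?thesis using g by (intro exI[of _ 1]) (simp add: g_def)
  next
    case False
    have "\<phi> (b i) I \<in> orbit G \<phi> I" using b by (auto simp: orbit_def)
    then obtain l where l: "l < p" "\<phi> (b i) I = \<phi> (g [^] l) I" using powers(1) by auto
    then have eq: "b i <# I = g [^] l <# I" using I(1) by (simp add: \<phi>_def)
    have "l \<noteq> 0" using eq moved[OF i] sub lcos_mult_one by (metis nat_pow_0)
    then show ?thesis using eq l False by (intro exI[of _ l]) auto
  qed
  then obtain l :: "nat \<Rightarrow> nat" where l: "\<And>i. i \<in> {1..d} \<Longrightarrow> b i <# I = g [^] l i <# I"
    "\<And>i. i \<in> {1..d} \<Longrightarrow> int (l i) \<in> (if i = 1 then {1} else {1..<int p})"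
    by metis
  define c where "c = (\<lambda>i\<in>{1..d}. int (l i))"
  have c: "c \<in> unit_coeffs d p"
    using l(2) by (auto simp: c_def unit_coeffs_def PiE_iff)
  \<comment> \<open>Nonnegativity is carried through the induction because the exponent is obtained
    with \<open>nat\<close>.\<close>
  have "linear_form d c x \<ge> 0 \<and> x <# I = g [^] nat (linear_form d c x) <# I" if x: "x \<in> carrier G" for x
  proof (rule zmod_power_induct[of n x d])
    show "n \<ge> 1" "x \<in> carrier (zmod_power d n)" using n x by (simp_all add: G_def)
    show "0 \<le> linear_form d c \<one>\<^bsub>zmod_power d n\<^esub> \<and>
        \<one>\<^bsub>zmod_power d n\<^esub> <# I = g [^] nat (linear_form d c \<one>\<^bsub>zmod_power d n\<^esub>) <# I"
      by (simp add: G_def)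
    fix x i
    assume x: "x \<in> carrier (zmod_power d n)" and i: "i \<in> {1..d}" "x i + 1 < int n"
      and IH: "0 \<le> linear_form d c x \<and> x <# I = g [^] nat (linear_form d c x) <# I"
    have lf: "linear_form d c (x(i := x i + 1)) = linear_form d c x + int (l i)"
      using linear_form_upd[OF i(1), of c x 1] i(1) by (simp add: c_def)
    have "x(i := x i + 1) = x \<otimes> b i"
      using zmod_power_mult_basis_vector[OF n x i] by (simp add: G_def b_def)
    moreover have "(x \<otimes> b i) <# I = g [^] (nat (linear_form d c x) + l i) <# I"
      using l_coset_mult_eq_pow[OF sub _ b g] x IH l(1)[OF i(1)]
      by (simp add: G_def)
    ultimately show "0 \<le> linear_form d c (x(i := x i + 1)) \<and>
        x(i := x i + 1) <# I = g [^] nat (linear_form d c (x(i := x i + 1))) <# I"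
      using IH lf by (simp add: nat_add_distrib)
  qed
  then have lf: "linear_form d c x \<ge> 0" "x <# I = g [^] nat (linear_form d c x) <# I"
    if "x \<in> carrier G" for x using that by auto
  have pow_mod: "g [^] a \<in> I \<longleftrightarrow> g [^] (a mod p) \<in> I" for a :: nat
    using act.action_pow_mod[OF I(1) g powers(2), of a] I(1) g sub
    by (intro mem_iff_of_l_coset_eq) (auto simp: \<phi>_def)
  \<comment> \<open>\<open>x\<close> and the power of \<open>g\<close> give the same translate of
    \<open>I\<close>, so both belong to \<open>I\<close> or neither does; \<open>pow_mod\<close>
    then reduces the exponent.\<close>
  have mem: "x \<in> I \<longleftrightarrow> g [^] nat (linear_form d c x mod int p) \<in> I" if x: "x \<in> carrier G" for x
  proof -
    have "x \<in> I \<longleftrightarrow> g [^] nat (linear_form d c x) \<in> I"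
      using lf(2)[OF x] g sub x by (intro mem_iff_of_l_coset_eq) auto
    also have "\<dots> \<longleftrightarrow> g [^] (nat (linear_form d c x) mod p) \<in> I" by (rule pow_mod)
    also have "nat (linear_form d c x) mod p = nat (linear_form d c x mod int p)"
      using lf(1)[OF x] by (simp add: nat_mod_distrib)
    finally show ?thesis .
  qed
  have succ: False if "g [^] a \<in> I" "g [^] Suc a \<in> I" for a :: nat
    using edge[of "g [^] a" 1] that d by (simp add: g_def)
  text \<open>For \<open>p \<le> 3\<close> any two distinct residues modulo \<open>p\<close> are cyclically adjacent, so \<open>I\<close> meets only
    one of them.\<close>
  have unique: "a = a'" if a: "a < p" "a' < p" "g [^] a \<in> I" "g [^] a' \<in> I" for a a' :: nat
  proof -
    have False if "a < a'" "a' < p" "g [^] a \<in> I" "g [^] a' \<in> I" for a a'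
    proof (cases "a' = Suc a")
      case True
      then show ?thesis using succ that by simp
    next
      case False
      \<comment> \<open>The only nonconsecutive pair is \<open>0\<close> and \<open>2\<close> modulo
        \<open>3\<close>; it is adjacent through the wraparound from \<open>2\<close> to
        \<open>3\<close>, which \<open>pow_mod\<close> identifies with \<open>0\<close>.\<close>
      then have "p = 3" "a = 0" "a' = 2" using that p by auto
      then have "g [^] Suc a' \<in> I" using pow_mod[of "Suc a'"] that by (simp add: numeral_3_eq_3)
      then show ?thesis using succ that(4) by simp
    qed
    then show ?thesis using a by (metis nat_neq_iff)
  qed
  \<comment> \<open>By \<open>unique\<close>, any single element of \<open>I\<close> determines the
    residue \<open>j\<close>.\<close>
  obtain y where y: "y \<in> I" using I(2) by blast
  define j where "j = linear_form d c y mod int p"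
  have p0: "int p > 0" using p by auto
  have j: "j \<in> {0..<int p}" using p0 by (simp add: j_def)
  have gj: "g [^] nat j \<in> I" using mem y sub by (auto simp: j_def)
  have "x \<in> I \<longleftrightarrow> linear_form d c x mod int p = j" if x: "x \<in> carrier G" for x
  proof
    assume "x \<in> I"
    then have "nat (linear_form d c x mod int p) = nat j"
      using mem[OF x] gj j p0 by (intro unique) (auto simp: nat_less_iff)
    then show "linear_form d c x mod int p = j"
      using j p0 by (simp add: nat_eq_iff)
  next
    assume "linear_form d c x mod int p = j"
    then show "x \<in> I" using mem[OF x] gj by simp
  qed
  then have "I = level_set d n p c j" using sub by (auto simp: level_set_def G_def)
  then show thesis using that c j by blast
qed

section \<open>Counting modulo \<open>p\<^sup>2\<close>, valuations and tameness\<close>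

text \<open>The sets with orbit smaller than \<open>p\<^sup>2\<close> are exactly the empty set and
  the level sets. The latter are nonempty and pairwise distinct, so they are counted by the pairs in
  \<open>D\<close>.\<close>

lemma num_indep_prime_power_cong:
  assumes p: "p = 2 \<or> p = 3" and k: "k \<ge> 1" and d: "d \<ge> 1"
  shows "[num_indep d (p ^ k) = 1 + p * (p - 1) ^ (d - 1)] (mod p\<^sup>2)"
proof -
  define n where "n = p ^ k"
  define G where "G = zmod_power d n"
  define E where "E = independent_sets (torus_graph d n)"
  define \<phi> where "\<phi> = (\<lambda>g. \<lambda>I\<in>E. g <#\<^bsub>G\<^esub> I)"
  have prime: "prime p" using p by auto
  have p1: "p > 1" using p by auto
  have n: "n > 1" using k p1 by (simp add: n_def one_less_power del: One_nat_def)
  have pn: "int p dvd int n" using k by (simp add: n_def dvd_power)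
  interpret comm_group G unfolding G_def by (rule comm_group_zmod_power)
  interpret act: group_action G E \<phi>
    using translation_action[of "torus_generators d n"] torus_generators_subset[of n d] n
    unfolding E_def \<phi>_def G_def torus_graph_def by simp
  have ord: "order G = p ^ (k * d)"
    using order_zmod_power[of n d] n by (simp add: G_def n_def power_mult)
  have "finite (carrier G)"
    using ord p1 order_gt_0_iff_finite by simp
  then have fin: "finite E"
    by (rule finite_subset[rotated, OF finite_Pow_iff[THEN iffD2]])
       (auto simp: E_def independent_sets_def torus_graph_def cayley_graph_def G_def)
  have "card E = num_indep d n" by (simp add: E_def num_indep_def)
  then have cong: "[num_indep d n = card {I \<in> E. card (orbit G \<phi> I) < p\<^sup>2}] (mod p\<^sup>2)"
    using act.card_cong_small_orbits[OF prime ord fin, of 2] by simp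
  define F where "F = (\<lambda>(c, j). level_set d n p c j)"
  define D where "D = unit_coeffs d p \<times> {0..<int p}"
  have "{I \<in> E. card (orbit G \<phi> I) < p\<^sup>2} = insert {} (F ` D)"
  proof (intro equalityI subsetI)
    fix I assume "I \<in> {I \<in> E. card (orbit G \<phi> I) < p\<^sup>2}"
    then have I: "I \<in> E" "card (orbit G \<phi> I) < p\<^sup>2" by simp_all
    show "I \<in> insert {} (F ` D)"
    proof (cases "I = {}")
      case False
      obtain c j where "c \<in> unit_coeffs d p" "j \<in> {0..<int p}" "I = level_set d n p c j"
        using small_orbit_is_level_set[OF p k d, folded n_def, folded G_def E_def, folded \<phi>_def,
            OF I(1) False I(2)] .
      then show ?thesis unfolding F_def D_def by blast
    qed simp
  next
    fix I assume "I \<in> insert {} (F ` D)"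
    then consider "I = {}" | c j where "I = level_set d n p c j" "c \<in> unit_coeffs d p" "j \<in> {0..<int p}"
      by (auto simp: F_def D_def)
    then show "I \<in> {I \<in> E. card (orbit G \<phi> I) < p\<^sup>2}"
    proof cases
      case 1
      \<comment> \<open>Edges have two elements, so the empty set is independent; every translation
        fixes it.\<close>
      have "\<not> e \<subseteq> {}" if "e \<in> snd (torus_graph d n)" for e
        using torus_graph_simple(2)[OF _ that] n by auto
      then have "I \<in> E" using 1 by (simp add: E_def independent_sets_def)
      moreover have "orbit G \<phi> I \<subseteq> {{}}"
        using 1 \<open>I \<in> E\<close> by (auto simp: orbit_def \<phi>_def l_coset_def)
      then have "card (orbit G \<phi> I) \<le> 1"
        using card_mono[of "{{}}" "orbit G \<phi> I"] by simp
      moreover have "1 < p\<^sup>2" using p1 by (simp add: one_less_power del: One_nat_def)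
      ultimately show ?thesis by simp
    next
      case 2
      have "I \<in> E" unfolding E_def 2(1) by (rule level_set_independent[OF n pn 2(2) p1])
      \<comment> \<open>Translation changes only the level and keeps \<open>c\<close>, which bounds
        the orbit by \<open>p\<close> sets.\<close>
      have "orbit G \<phi> I \<subseteq> level_set d n p c ` {0..<int p}"
      proof
        fix J assume "J \<in> orbit G \<phi> I"
        then obtain g where g: "g \<in> carrier G" "J = \<phi> g I" by (auto simp: orbit_def)
        then have "J = g <#\<^bsub>G\<^esub> level_set d n p c j"
          using \<open>I \<in> E\<close> by (simp add: \<phi>_def 2(1))
        also have "\<dots> = level_set d n p c ((linear_form d c g + j) mod int p)"
          using level_set_translate_eq[OF pn _ 2(3)] g(1) by (simp add: G_def)
        finally show "J \<in> level_set d n p c ` {0..<int p}" using p1 by simp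
      qed
      then have "card (orbit G \<phi> I) \<le> card {0..<int p}"
        by (rule surj_card_le[rotated]) simp
      also have "\<dots> < p\<^sup>2" using p1 by (simp add: power2_eq_square)
      finally show ?thesis using \<open>I \<in> E\<close> by simp
    qed
  qed
  moreover have "inj_on F D"
    using level_set_injective[OF n pn p1 d] by (auto simp: inj_on_def F_def D_def)
  moreover have "{} \<notin> F ` D"
    using level_set_nonempty[OF n pn p1 d] by (force simp: F_def D_def)
  moreover have "finite D"
    using p1 by (auto simp: D_def unit_coeffs_def intro!: finite_PiE)
  moreover have "card D = p * (p - 1) ^ (d - 1)"
    by (simp add: D_def card_cartesian_product card_unit_coeffs[OF d])
  ultimately have "card {I \<in> E. card (orbit G \<phi> I) < p\<^sup>2} = 1 + p * (p - 1) ^ (d - 1)"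
    by (simp add: card_image)
  then show ?thesis using cong by (simp add: n_def)
qed

text \<open>Modulo \<open>p\<^sup>2\<close>, the number \<open>N\<close> is \<open>p * u\<close>
  with \<open>u\<close> a power of \<open>p - 1\<close>, hence prime to \<open>p\<close>. So
  \<open>p\<close> divides \<open>N\<close> exactly once, whatever \<open>k\<close> is.\<close>

lemma multiplicity_num_indep:
  assumes p: "p = 2 \<or> p = 3" and k: "k \<ge> 1" and d: "d \<ge> 1"
  shows "multiplicity (int p) (int (num_indep d (p ^ k)) - 1) = 1"
proof -
  define N where "N = int (num_indep d (p ^ k)) - 1"
  define u where "u = int (p - 1) ^ (d - 1)"
  have prime: "prime p" using p by auto
  have "[int (num_indep d (p ^ k)) = int (1 + p * (p - 1) ^ (d - 1))] (mod int (p\<^sup>2))"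
    using num_indep_prime_power_cong[OF assms] by (simp only: cong_int_iff)
  then have "[N = int p * u] (mod (int p)\<^sup>2)"
    unfolding N_def u_def using cong_diff[OF _ cong_refl, of _ _ _ 1] by fastforce
  then have N: "(int p)\<^sup>2 dvd N - int p * u" by (simp add: cong_iff_dvd_diff)
  have u: "\<not> int p dvd u"
  proof
    assume "int p dvd u"
    then have "int p dvd int (p - 1)"
      unfolding u_def using prime prime_dvd_power_int prime_nat_int_transfer by blast
    then show False using p by auto
  qed
  have "int p dvd N - int p * u" using N by (metis dvd_trans dvd_triv_left power2_eq_square)
  then have "int p dvd N" by (simp add: dvd_diff_left_iff)
  moreover have "\<not> (int p)\<^sup>2 dvd N"
  proof
    assume "(int p)\<^sup>2 dvd N"
    then have "(int p)\<^sup>2 dvd int p * u" using N dvd_diff_right_iff by blast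
    then show False using u p by (auto simp: power2_eq_square)
  qed
  ultimately have "multiplicity (int p) N = 1"
    by (intro multiplicity_eqI) (simp_all add: numeral_2_eq_2)
  then show ?thesis by (simp add: N_def)
qed

theorem corollary3p24:
  fixes d :: nat
  assumes "d \<ge> 1"
  shows "[num_indep d 2 = 3] (mod 4) \<and>
         [num_indep d 3 = 1 + 3 * 2 ^ (d - 1)] (mod 9) \<and>
         tame d 2 \<and> tame d 3 \<and>
         multiplicity (2::int) (int (num_indep d 2) - 1) = 1 \<and>
         multiplicity (3::int) (int (num_indep d 3) - 1) = 1"
proof -
  have mult: "multiplicity (int p) (int (num_indep d (p ^ k)) - 1) = 1"
    if "p = 2 \<or> p = 3" "k \<ge> 1" for p k
    using multiplicity_num_indep[OF that assms] .
  have m1: "multiplicity (int p) (int (num_indep d p) - 1) = 1" if "p = 2 \<or> p = 3" for p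
    using mult[OF that, of 1] by simp
  have "tame d p" if "p = 2 \<or> p = 3" for p
    using mult[OF that] m1[OF that] that by (auto simp: tame_def)
  \<comment> \<open>For \<open>p = 2\<close> the factor \<open>(p - 1) ^ (d - 1)\<close> is
    \<open>1\<close>, so the residue does not depend on \<open>d\<close>.\<close>
  moreover have "[num_indep d 2 = 3] (mod 4)"
    using num_indep_prime_power_cong[of 2 1 d] assms by (simp add: numeral_3_eq_3)
  moreover have "[num_indep d 3 = 1 + 3 * 2 ^ (d - 1)] (mod 9)"
    using num_indep_prime_power_cong[of 3 1 d] assms by simp
  ultimately show ?thesis using m1[of 2] m1[of 3] by simp
qed

end
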